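(* Let $f:\mathbb{R}^n\to\mathbb{R}$ be an $m_f$-strongly convex function (with $m_f>0$) whose gradient $\nabla f$ is $L_f$-Lipschitz continuous, let $g:\mathbb{R}^n\to\mathbb{R}$ be a proper, closed, and convex (not necessarily differentiable) function, and let $\mu\in(0,2/L_f)$. Set $\sigma=\max\{|1-\mu m_f|,\,|1-\mu L_f|\}$. Consider the proximal gradient flow dynamics $$\dot z \;=\; -z+\mathrm{prox}_{\mu g}\bigl(z-\mu\nabla f(z)\bigr),$$ and let $z^\star$ be its equilibrium point. Then $z^\star$ is globally $\rho$-exponentially stable, i.e., there exist $c>0$ and $\rho\in(0,1-\sigma]$ such that every solution $z(t)$ of the dynamics satisfies $$\|z(t)-z^\star\|_2\;\le\; c\,\mathrm{e}^{-\rho t}\,\|z(0)-z^\star\|_2,\qquad \forall\, t\ge 0.$$ Moreover, $x^\star=z^\star$ is the optimal solution of the problem $\min_{x\in\mathbb{R}^n}\; f(x)+g(x)$.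
   Context: For a proper, closed, convex function $g$ on $\mathbb{R}^n$ and a parameter $\mu>0$, the proximal operator is $$\mathrm{prox}_{\mu g}(v):=\operatorname*{argmin}_{z}\Bigl(g(z)+\tfrac{1}{2\mu}\|z-v\|_2^2\Bigr),$$ which is single-valued. A differentiable function $f$ is $m_f$-strongly convex if $f(\hat x)\ge f(x)+\langle\nabla f(x),\hat x-x\rangle+\frac{m_f}{2}\|\hat x-x\|_2^2$ for all $x,\hat x$. The equilibrium point $z^\star$ is the point at which the right-hand side of the dynamics vanishes. The constants $c$ and $\rho$ do not depend on the solution (i.e., on the initial condition). *)

theory Defs
  imports "HOL-Analysis.Analysis"
begin

definition gradient :: "('a::euclidean_space \<Rightarrow> real) \<Rightarrow> 'a \<Rightarrow> 'a" where
  "gradient f x = (THE D. GDERIV f x :> D)"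

lemma GDERIV_gradient:
  fixes f :: "'a::euclidean_space \<Rightarrow> real"
  assumes "f differentiable (at x)"
  shows "GDERIV f x :> gradient f x"
proof -
  obtain f' where f': "(f has_derivative f') (at x)"
    using assms by (auto simp: differentiable_def)
  then interpret bounded_linear f' by (rule has_derivative_bounded_linear)
  have "f' h = inner h (adjoint f' 1)" for h
    using adjoint_works[OF linear_axioms, of h 1] by simp
  then obtain D where "f' = (\<lambda>h. inner h D)"
    by (rule that[OF ext])
  then have D: "GDERIV f x :> D"
    using f' by (simp add: gderiv_def)
  have unique: "E = D" if "GDERIV f x :> E" for E
  proof -
    have "(\<lambda>h. inner h E) = (\<lambda>h. inner h D)"
      using that D unfolding gderiv_def by (rule has_derivative_unique)
    then have "\<forall>h. inner h E = inner h D"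
      by (rule fun_cong[THEN allI])
    then show ?thesis
      by (rule vector_eq_ldot[THEN iffD1])
  qed
  show ?thesis
    unfolding gradient_def using D unique by (rule theI)
qed

definition strongly_convex :: "real \<Rightarrow> ('a::euclidean_space \<Rightarrow> real) \<Rightarrow> bool" where
  "strongly_convex m f \<longleftrightarrow>
     (\<forall>x. f differentiable (at x)) \<and>
     (\<forall>x y. f y \<ge> f x + inner (gradient f x) (y - x) + m / 2 * (norm (y - x))\<^sup>2)"

(* Proper, closed and convex are notions for extended-real-valued functions; a function with
   values in the reals is treated as the composition with the embedding into ereal, see the lemma
   proper_closed_convex_real below. *)

definition ereal_epigraph :: "('a \<Rightarrow> ereal) \<Rightarrow> ('a \<times> real) set" where
  "ereal_epigraph g = {(x, r). g x \<le> ereal r}"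

definition proper_fun :: "('a \<Rightarrow> ereal) \<Rightarrow> bool" where
  "proper_fun g \<longleftrightarrow> (\<forall>x. g x \<noteq> -\<infinity>) \<and> (\<exists>x. g x \<noteq> \<infinity>)"

definition closed_fun :: "('a::topological_space \<Rightarrow> ereal) \<Rightarrow> bool" where
  "closed_fun g \<longleftrightarrow> closed (ereal_epigraph g)"

definition convex_fun :: "('a::real_vector \<Rightarrow> ereal) \<Rightarrow> bool" where
  "convex_fun g \<longleftrightarrow> convex (ereal_epigraph g)"

lemma proper_closed_convex_real:
  fixes g :: "'a::euclidean_space \<Rightarrow> real"
  assumes "convex_on UNIV g"
  shows "proper_fun (\<lambda>x. ereal (g x))" "closed_fun (\<lambda>x. ereal (g x))"
    "convex_fun (\<lambda>x. ereal (g x))"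
proof -
  have epi: "ereal_epigraph (\<lambda>x. ereal (g x)) = epigraph UNIV g"
    by (auto simp: ereal_epigraph_def epigraph_def)
  have "continuous_on UNIV g"
    using convex_on_continuous[OF open_UNIV assms] .
  then have "continuous_on UNIV (\<lambda>xy :: 'a \<times> real. g (fst xy))"
    by (rule continuous_on_compose2) (simp_all add: continuous_on_fst)
  then have "closed {xy :: 'a \<times> real. g (fst xy) \<le> snd xy}"
    by (rule closed_Collect_le) (simp add: continuous_on_snd)
  then show "closed_fun (\<lambda>x. ereal (g x))"
    unfolding closed_fun_def epi by (simp add: epigraph_def)
  show "convex_fun (\<lambda>x. ereal (g x))"
    unfolding convex_fun_def epi using assms by (rule convex_epigraphI)
  show "proper_fun (\<lambda>x. ereal (g x))"
    by (simp add: proper_fun_def)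
qed

(* The value is a minimizer only when one exists, which holds for proper closed convex g and
   \<mu> > 0; the minimizer is then unique. *)
definition prox :: "real \<Rightarrow> ('a::euclidean_space \<Rightarrow> ereal) \<Rightarrow> 'a \<Rightarrow> 'a" where
  "prox \<mu> g v = arg_min (\<lambda>z. g z + ereal (1 / (2 * \<mu>) * (norm (z - v))\<^sup>2)) (\<lambda>z. True)"

definition prox_grad_field ::
    "real \<Rightarrow> ('a::euclidean_space \<Rightarrow> real) \<Rightarrow> ('a \<Rightarrow> ereal) \<Rightarrow> 'a \<Rightarrow> 'a" where
  "prox_grad_field \<mu> f g z = - z + prox \<mu> g (z - \<mu> *\<^sub>R gradient f z)"

definition equilibrium :: "('a::real_normed_vector \<Rightarrow> 'a) \<Rightarrow> 'a \<Rightarrow> bool" where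
  "equilibrium F z \<longleftrightarrow> F z = 0"

(* Only the values on [0, \<infinity>) matter; the derivative at 0 is one-sided. *)
definition ode_solution :: "('a::real_normed_vector \<Rightarrow> 'a) \<Rightarrow> (real \<Rightarrow> 'a) \<Rightarrow> bool" where
  "ode_solution F z \<longleftrightarrow>
     (\<forall>t\<ge>0. (z has_vector_derivative F (z t)) (at t within {0..}))"

end

theory Submission
  imports Defs
begin

text \<open>
  A point \<open>x\<close> minimizes \<open>f + g\<close> iff \<open>- \<nabla>f(x)\<close> is a subgradient of \<open>g\<close> at \<open>x\<close>, which is also the condition
  that \<open>x\<close> is a fixed point of \<open>T(z) = prox(z - \<mu> \<nabla>f(z))\<close>. The proximal map is nonexpansive, and the
  gradient step contracts by \<open>\<sigma>\<close> because \<open>\<nabla>f - m id\<close> is cocoercive; hence \<open>T\<close> contracts by \<open>\<sigma>\<close>, and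
  along the flow \<open>z' = T(z) - z\<close> the quantity \<open>exp(2(1 - \<sigma>)t) |z(t) - z*|\<^sup>2\<close> does not increase. So
  \<open>c = 1\<close> and \<open>\<rho> = 1 - \<sigma>\<close> work.
\<close>

section \<open>Subgradients and minimizers of a sum \<open>f + g\<close>\<close>

text \<open>Finiteness excludes \<open>g x = -\<infinity>\<close>, where the inequality would hold
  for every \<open>u\<close>, and lets subgradient inequalities be added and cancelled in the
  reals.\<close>

definition subgradient :: "('a::real_inner \<Rightarrow> ereal) \<Rightarrow> 'a \<Rightarrow> 'a \<Rightarrow> bool" where
  "subgradient g x u \<longleftrightarrow> \<bar>g x\<bar> \<noteq> \<infinity> \<and> (\<forall>y. g x + ereal (u \<bullet> (y - x)) \<le> g y)"

lemma subgradient_monotone: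
  assumes "subgradient g x u" "subgradient g y v"
  shows "(u - v) \<bullet> (x - y) \<ge> 0"
proof -
  obtain a b where ab: "g x = ereal a" "g y = ereal b"
    using assms unfolding subgradient_def by (metis ereal_real)
  have "g x + ereal (u \<bullet> (y - x)) \<le> g y" "g y + ereal (v \<bullet> (x - y)) \<le> g x"
    using assms unfolding subgradient_def by blast+
  then show ?thesis
    using ab by (simp add: inner_diff)
qed

text \<open>The point \<open>(x0, r0 - 1)\<close>, one unit below the graph, is strictly separated
  from the closed convex epigraph; the hyperplane solved for its last coordinate is the
  minorant.\<close>

lemma closed_convex_affine_minorant:
  fixes g :: "'a::euclidean_space \<Rightarrow> ereal"
  assumes "proper_fun g" "closed_fun g" "convex_fun g"
  obtains \<alpha> \<beta> where "\<And>x r. g x \<le> ereal r \<Longrightarrow> \<alpha> + \<beta> \<bullet> x \<le> r"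
proof -
  obtain x0 r0 where x0: "g x0 = ereal r0"
    using assms(1) unfolding proper_fun_def by (metis ereal_cases)
  have "(x0, r0 - 1) \<notin> ereal_epigraph g"
    using x0 by (simp add: ereal_epigraph_def)
  then obtain w c where w: "w \<bullet> (x0, r0 - 1) < c" "\<And>p. p \<in> ereal_epigraph g \<Longrightarrow> c < w \<bullet> p"
    using separating_hyperplane_closed_point[of "ereal_epigraph g" "(x0, r0 - 1)"] assms(2,3)
    unfolding closed_fun_def convex_fun_def by blast
  obtain a b where ab: "w = (a, b)"
    by (cases w)
  have sep: "c < a \<bullet> x + b * r" if "g x \<le> ereal r" for x r
    using w(2)[of "(x, r)"] that ab by (simp add: ereal_epigraph_def)
  \<comment> \<open>\<open>(x0, r0)\<close> and \<open>(x0, r0 - 1)\<close> lie on opposite sides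
    and differ only vertically, so the hyperplane is not vertical.\<close>
  have "b > 0"
    using sep[of x0 r0] w(1) x0 ab by (simp add: algebra_simps)
  have "c / b + (- (1 / b) *\<^sub>R a) \<bullet> x \<le> r" if "g x \<le> ereal r" for x r
    using sep[OF that] \<open>b > 0\<close> by (simp add: field_simps)
  then show ?thesis
    by (rule that)
qed

text \<open>Quadratic growth of \<open>f\<close> around one point \<open>x0\<close> outweighs the
  affine minorant of \<open>g\<close>, so the sum is coercive. This serves twice: for the objective
  of \<open>prox\<close> and for \<open>f + g\<close> itself.\<close>

lemma composite_minimizer_exists:
  fixes f :: "'a::euclidean_space \<Rightarrow> real" and g :: "'a \<Rightarrow> ereal"
  assumes g: "proper_fun g" "closed_fun g" "convex_fun g"
    and cont: "continuous_on UNIV f" and "m > 0"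
    and lower: "\<And>x. f x0 + G \<bullet> (x - x0) + m / 2 * (norm (x - x0))\<^sup>2 \<le> f x"
  obtains x where "is_arg_min (\<lambda>x. ereal (f x) + g x) (\<lambda>x. True) x"
proof -
  \<comment> \<open>On the epigraph of \<open>g\<close> the objective becomes the continuous function \<open>f x + r\<close>, whose sublevel
    set \<open>S\<close> is compact.\<close>
  obtain \<alpha> \<beta> where minor: "\<And>x r. g x \<le> ereal r \<Longrightarrow> \<alpha> + \<beta> \<bullet> x \<le> r"
    using closed_convex_affine_minorant[OF g] by blast
  obtain x1 r1 where x1: "g x1 = ereal r1"
    using g(1) unfolding proper_fun_def by (metis ereal_cases)
  define K where "K = f x1 + r1"
  define S where "S = {p. g (fst p) \<le> ereal (snd p) \<and> f (fst p) + snd p \<le> K}"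
  \<comment> \<open>On \<open>S\<close> the two lower bounds add up to \<open>w \<bullet> (x - x0) +
    m / 2 * (norm (x - x0))\<^sup>2 \<le> D\<close>. Beyond radius \<open>R\<close> the quadratic
    term exceeds \<open>(norm w + D) * norm (x - x0)\<close>, and the summand 1 in \<open>R\<close>
    gives \<open>D \<le> D * norm (x - x0)\<close>.\<close>
  define w where "w = G + \<beta>"
  define D where "D = \<bar>K - f x0 - \<alpha> - \<beta> \<bullet> x0\<bar>"
  define R where "R = 1 + 2 / m * (norm w + D)"
  have cf: "continuous_on UNIV (\<lambda>p::'a \<times> real. f (fst p) + snd p)"
    by (intro continuous_intros continuous_on_compose2[OF cont]) auto
  have "S = ereal_epigraph g \<inter> {p. f (fst p) + snd p \<le> K}"
    by (auto simp: S_def ereal_epigraph_def)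
  moreover have "closed {p::'a \<times> real. f (fst p) + snd p \<le> K}"
    by (rule closed_Collect_le[OF cf]) simp
  ultimately have "closed S"
    using g(2) by (simp add: closed_fun_def closed_Int)
  have R: "norm (x - x0) \<le> R" if "(x, r) \<in> S" for x r
  proof (rule ccontr)
    assume "\<not> norm (x - x0) \<le> R"
    then have n: "norm (x - x0) > R" by simp
    have "R \<ge> 1"
      using \<open>m > 0\<close> by (simp add: R_def D_def)
    have "\<alpha> + \<beta> \<bullet> x \<le> r" "f x + r \<le> K"
      using that minor by (auto simp: S_def)
    then have "w \<bullet> (x - x0) + m / 2 * (norm (x - x0))\<^sup>2 \<le> D"
      using lower[of x] unfolding D_def w_def by (simp add: inner_diff_right inner_add_left)
    moreover have "- (norm w * norm (x - x0)) \<le> w \<bullet> (x - x0)"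
      using Cauchy_Schwarz_ineq2[of w "x - x0"] by linarith
    moreover have "norm w * norm (x - x0) + D * norm (x - x0) < m / 2 * (norm (x - x0))\<^sup>2"
    proof -
      have "norm w + D < m / 2 * norm (x - x0)"
        using n \<open>m > 0\<close> by (simp add: R_def field_simps)
      then have "(norm w + D) * norm (x - x0) < (m / 2 * norm (x - x0)) * norm (x - x0)"
        using n \<open>R \<ge> 1\<close> by (intro mult_strict_right_mono) auto
      then show ?thesis by (simp add: power2_eq_square distrib_right)
    qed
    moreover have "D * 1 \<le> D * norm (x - x0)"
      using n \<open>R \<ge> 1\<close> by (intro mult_left_mono) (auto simp: D_def)
    ultimately show False
      by linarith
  qed
  \<comment> \<open>The minorant of \<open>g\<close> bounds \<open>r\<close> from below;
    \<open>r \<le> K - f x\<close> and the linear lower bound of \<open>f\<close> on the ball bound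
    it from above.\<close>
  have "S \<subseteq> cball x0 R \<times> {\<alpha> + \<beta> \<bullet> x0 - norm \<beta> * R .. K - f x0 + norm G * R}"
  proof safe
    fix x r assume S: "(x, r) \<in> S"
    note n = R[OF S]
    then show "x \<in> cball x0 R"
      by (simp add: dist_norm norm_minus_commute)
    have "\<bar>u \<bullet> (x - x0)\<bar> \<le> norm u * R" for u
      using Cauchy_Schwarz_ineq2[of u "x - x0"] mult_left_mono[OF n, of "norm u"] by simp
    note b = this[of \<beta>] this[of G]
    have mem: "\<alpha> + \<beta> \<bullet> x \<le> r" "f x + r \<le> K"
      using S minor by (auto simp: S_def)
    have "0 \<le> m / 2 * (norm (x - x0))\<^sup>2"
      using \<open>m > 0\<close> by simp
    then have "f x0 + G \<bullet> (x - x0) \<le> f x"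
      using lower[of x] by linarith
    then show "r \<in> {\<alpha> + \<beta> \<bullet> x0 - norm \<beta> * R .. K - f x0 + norm G * R}"
      using b mem by (simp add: inner_diff_right abs_le_iff)
  qed
  then have "bounded S"
    by (rule bounded_subset[rotated]) (intro bounded_Times bounded_cball bounded_closed_interval)
  with \<open>closed S\<close> have "compact S"
    by (simp add: compact_eq_bounded_closed)
  moreover have S1: "(x1, r1) \<in> S"
    using x1 by (simp add: S_def K_def)
  ultimately obtain x r where xr: "(x, r) \<in> S"
    and min: "\<And>p. p \<in> S \<Longrightarrow> f x + r \<le> f (fst p) + snd p"
    using continuous_attains_inf[of S "\<lambda>p. f (fst p) + snd p"] continuous_on_subset[OF cf]
    by (metis empty_iff prod.collapse fst_conv snd_conv subset_UNIV)
  \<comment> \<open>Outside \<open>S\<close> the value exceeds \<open>K\<close>, while the minimum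
    over \<open>S\<close> is at most \<open>K\<close>; so it is global.\<close>
  have all: "f x + r \<le> f y + s" if "g y \<le> ereal s" for y s
  proof (cases "f y + s \<le> K")
    case True
    then show ?thesis using min[of "(y, s)"] that by (simp add: S_def)
  next
    case False
    then show ?thesis using xr by (simp add: S_def)
  qed
  have "ereal (f x) + g x \<le> ereal (f y) + g y" for y
  proof -
    have "ereal (f x) + g x \<le> ereal (f x) + ereal r"
      using xr by (intro add_left_mono) (simp add: S_def)
    also have "\<dots> \<le> ereal (f y) + g y"
      using all[of y] g(1) by (cases "g y") (auto simp: proper_fun_def)
    finally show ?thesis .
  qed
  then have "is_arg_min (\<lambda>x. ereal (f x) + g x) (\<lambda>x. True) x"
    by (simp add: is_arg_min_linorder)
  then show ?thesis by (rule that)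
qed

text \<open>Moving from \<open>x\<close> the fraction \<open>t\<close> towards \<open>y\<close>
  raises \<open>f\<close> by at most \<open>t * (G \<bullet> (y - x))\<close> plus a term of order
  \<open>t\<^sup>2\<close>, and \<open>g\<close> by at most \<open>t * (g y - g x)\<close> by
  convexity. Minimality makes the total nonnegative; divide by \<open>t\<close> and let
  \<open>t\<close> tend to 0.\<close>

lemma minimizer_imp_subgradient:
  fixes f :: "'a::euclidean_space \<Rightarrow> real" and g :: "'a \<Rightarrow> ereal"
  assumes g: "proper_fun g" "convex_fun g"
    and upper: "\<And>y. f y \<le> f x + G \<bullet> (y - x) + L / 2 * (norm (y - x))\<^sup>2"
    and min: "is_arg_min (\<lambda>x. ereal (f x) + g x) (\<lambda>x. True) x"
  shows "subgradient g x (- G)"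
proof -
  have min: "ereal (f x) + g x \<le> ereal (f y) + g y" for y
    using min by (simp add: is_arg_min_linorder)
  obtain x1 r1 where "g x1 = ereal r1"
    using g(1) unfolding proper_fun_def by (metis ereal_cases)
  then obtain a where a: "g x = ereal a"
    using min[of x1] g(1) by (cases "g x") (auto simp: proper_fun_def)
  have "g x + ereal (- G \<bullet> (y - x)) \<le> g y" for y
  proof (cases "g y")
    case (real b)
    define s where "s = G \<bullet> (y - x) + b - a"
    define C where "C = L / 2 * (norm (y - x))\<^sup>2"
    have "0 \<le> s + t * C" if t: "0 < t" "t \<le> 1" for t
    proof -
      define z where "z = x + t *\<^sub>R (y - x)"
      have "(1 - t) *\<^sub>R (x, a) + t *\<^sub>R (y, b) \<in> ereal_epigraph g"
        using g(2) t a real unfolding convex_fun_def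
        by (intro convexD) (auto simp: ereal_epigraph_def)
      then have "g z \<le> ereal (a + t * (b - a))"
        by (simp add: ereal_epigraph_def z_def algebra_simps)
      then have "ereal (f z) + g z \<le> ereal (f z) + ereal (a + t * (b - a))"
        by (intro add_left_mono)
      with min[of z] a have "ereal (f x + a) \<le> ereal (f z + (a + t * (b - a)))"
        using order.trans by fastforce
      moreover have "f z \<le> f x + t * (G \<bullet> (y - x)) + t\<^sup>2 * C"
      proof -
        have "z - x = t *\<^sub>R (y - x)" by (simp add: z_def)
        then show ?thesis
          using upper[of z] by (simp add: C_def power_mult_distrib mult_ac)
      qed
      ultimately have "0 \<le> t * (s + t * C)"
        by (simp add: s_def power2_eq_square algebra_simps)
      then show ?thesis
        using t by (simp add: zero_le_mult_iff)
    qed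
    then have "\<forall>\<^sub>F t in at_right 0. 0 \<le> s + t * C"
      unfolding eventually_at_right_field by (intro exI[of _ 1]) auto
    moreover have "((\<lambda>t. s + t * C) \<longlongrightarrow> s + 0 * C) (at_right 0)"
      by (intro tendsto_intros)
    ultimately have "0 \<le> s"
      using tendsto_lowerbound by fastforce
    then show ?thesis
      using a real by (simp add: s_def)
  qed (use g(1) in \<open>auto simp: proper_fun_def\<close>)
  then show ?thesis
    using a by (simp add: subgradient_def)
qed

text \<open>When the two first-order bounds are added, the slopes \<open>G\<close> and
  \<open>- G\<close> cancel.\<close>

lemma subgradient_imp_minimizer:
  fixes f :: "'a::real_inner \<Rightarrow> real"
  assumes lower: "\<And>y. f x + G \<bullet> (y - x) \<le> f y"
    and sub: "subgradient g x (- G)"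
  shows "is_arg_min (\<lambda>x. ereal (f x) + g x) (\<lambda>x. True) x"
proof -
  obtain a where a: "g x = ereal a"
    using sub unfolding subgradient_def by (metis ereal_real)
  have "ereal (f x) + g x \<le> ereal (f y) + g y" for y
  proof -
    have "g x + ereal (- G \<bullet> (y - x)) \<le> g y"
      using sub by (simp add: subgradient_def)
    then show ?thesis
      using lower[of y] a by (cases "g y") auto
  qed
  then show ?thesis
    by (simp add: is_arg_min_linorder)
qed

section \<open>The proximal operator\<close>

text \<open>The vector \<open>(1 / \<mu>) *\<^sub>R (v - p)\<close> is minus the gradient at
  \<open>p\<close> of the quadratic term \<open>q\<close>. The second-order expansion of
  \<open>q\<close> is exact, so it supplies both the lower bound for existence and the upper bound
  for the optimality condition.\<close>

lemma prox_eq_iff_subgradient: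
  fixes g :: "'a::euclidean_space \<Rightarrow> ereal"
  assumes g: "proper_fun g" "closed_fun g" "convex_fun g" and "\<mu> > 0"
  shows "prox \<mu> g v = p \<longleftrightarrow> subgradient g p ((1 / \<mu>) *\<^sub>R (v - p))"
proof -
  define q where "q x = 1 / (2 * \<mu>) * (norm (x - v))\<^sup>2" for x
  define G where "G x = - ((1 / \<mu>) *\<^sub>R (v - x))" for x
  have expand: "q y = q x + G x \<bullet> (y - x) + (1 / \<mu>) / 2 * (norm (y - x))\<^sup>2" for x y
    using \<open>\<mu> > 0\<close> unfolding q_def G_def power2_norm_eq_inner
    by (simp add: field_simps inner_simps inner_commute)
  have lower: "q x + G x \<bullet> (y - x) \<le> q y" for x y
    using expand[of y x] \<open>\<mu> > 0\<close> by simp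
  have prox: "prox \<mu> g v = arg_min (\<lambda>z. ereal (q z) + g z) (\<lambda>z. True)"
    by (simp add: prox_def q_def add.commute)
  \<comment> \<open>\<open>arg_min\<close> is a choice operator, so a minimizer must exist before
    \<open>prox\<close> is known to be one.\<close>
  obtain x where "is_arg_min (\<lambda>x. ereal (q x) + g x) (\<lambda>x. True) x"
  proof (rule composite_minimizer_exists[OF g])
    show "continuous_on UNIV q"
      unfolding q_def by (intro continuous_intros)
    show "q v + G v \<bullet> (x - v) + (1 / \<mu>) / 2 * (norm (x - v))\<^sup>2 \<le> q x" for x
      using expand[of x v] by simp
  qed (use \<open>\<mu> > 0\<close> in auto)
  then have "is_arg_min (\<lambda>x. ereal (q x) + g x) (\<lambda>x. True) (prox \<mu> g v)"
    unfolding prox arg_min_def by (rule someI)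
  then have "subgradient g (prox \<mu> g v) (- G (prox \<mu> g v))"
    by (rule minimizer_imp_subgradient[OF g(1,3), where L = "1 / \<mu>", rotated])
      (simp only: expand[symmetric] order.refl)
  then have sub: "subgradient g (prox \<mu> g v) ((1 / \<mu>) *\<^sub>R (v - prox \<mu> g v))"
    by (simp add: G_def)
  \<comment> \<open>The two subgradients differ by \<open>- (1 / \<mu>)\<close> times the difference
    of the points, so monotonicity forces that difference to be zero.\<close>
  have "prox \<mu> g v = p" if "subgradient g p ((1 / \<mu>) *\<^sub>R (v - p))"
  proof -
    have "((1 / \<mu>) *\<^sub>R (v - prox \<mu> g v) - (1 / \<mu>) *\<^sub>R (v - p)) \<bullet> (prox \<mu> g v - p) \<ge> 0"
      by (rule subgradient_monotone[OF sub that])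
    also have "(1 / \<mu>) *\<^sub>R (v - prox \<mu> g v) - (1 / \<mu>) *\<^sub>R (v - p) = - (1 / \<mu>) *\<^sub>R (prox \<mu> g v - p)"
      by (simp add: algebra_simps)
    finally have "(1 / \<mu>) * (norm (prox \<mu> g v - p))\<^sup>2 \<le> 0"
      by (simp add: power2_norm_eq_inner)
    then show ?thesis
      using \<open>\<mu> > 0\<close> by (simp add: divide_le_0_iff)
  qed
  with sub show ?thesis by blast
qed

text \<open>Monotonicity of subgradients at the two images gives firm nonexpansiveness,
  \<open>(norm (p - q))\<^sup>2 \<le> (v - w) \<bullet> (p - q)\<close>; Cauchy-Schwarz does the
  rest.\<close>

lemma prox_nonexpansive:
  fixes g :: "'a::euclidean_space \<Rightarrow> ereal"
  assumes g: "proper_fun g" "closed_fun g" "convex_fun g" and "\<mu> > 0"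
  shows "norm (prox \<mu> g v - prox \<mu> g w) \<le> norm (v - w)"
proof -
  define p q where pq: "p = prox \<mu> g v" "q = prox \<mu> g w"
  have "subgradient g p ((1 / \<mu>) *\<^sub>R (v - p))" "subgradient g q ((1 / \<mu>) *\<^sub>R (w - q))"
    using prox_eq_iff_subgradient[OF assms] pq by blast+
  then have "((1 / \<mu>) *\<^sub>R (v - p) - (1 / \<mu>) *\<^sub>R (w - q)) \<bullet> (p - q) \<ge> 0"
    by (rule subgradient_monotone)
  also have "(1 / \<mu>) *\<^sub>R (v - p) - (1 / \<mu>) *\<^sub>R (w - q) = (1 / \<mu>) *\<^sub>R ((v - w) - (p - q))"
    by (simp add: algebra_simps)
  finally have "(norm (p - q))\<^sup>2 \<le> (v - w) \<bullet> (p - q)"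
    using \<open>\<mu> > 0\<close> by (simp add: inner_diff_left zero_le_divide_iff power2_norm_eq_inner)
  also have "\<dots> \<le> norm (v - w) * norm (p - q)"
    by (rule norm_cauchy_schwarz)
  finally show ?thesis
    unfolding pq[symmetric] by (cases "p = q") (simp_all add: power2_eq_square)
qed

section \<open>Contraction of the gradient step\<close>

lemma lipschitz_gradient_upper_bound:
  fixes f :: "'a::real_inner \<Rightarrow> real"
  assumes deriv: "\<And>x. GDERIV f x :> G x" and lip: "L-lipschitz_on UNIV G"
  shows "f y \<le> f x + G x \<bullet> (y - x) + L / 2 * (norm (y - x))\<^sup>2"
proof -
  define d where "d = y - x"
  \<comment> \<open>Chosen so that the claim reads \<open>\<phi> 1 \<le> \<phi> 0\<close>; the
    Lipschitz bound makes the derivative of \<open>\<phi>\<close> nonpositive on the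
    segment.\<close>
  define \<phi> where "\<phi> t = f (x + t *\<^sub>R d) - t * (G x \<bullet> d) - L / 2 * t\<^sup>2 * (norm d)\<^sup>2" for t
  have D: "(\<phi> has_real_derivative ((G (x + t *\<^sub>R d) - G x) \<bullet> d - L * t * (norm d)\<^sup>2)) (at t)" for t
  proof -
    have "(f has_derivative (\<lambda>h. h \<bullet> G (x + t *\<^sub>R d))) (at (x + t *\<^sub>R d))"
      using deriv by (simp add: gderiv_def)
    moreover have "((\<lambda>t. x + t *\<^sub>R d) has_derivative (\<lambda>s. s *\<^sub>R d)) (at t)"
      by (auto intro!: derivative_eq_intros)
    ultimately have "((\<lambda>t. f (x + t *\<^sub>R d)) has_derivative (\<lambda>s. (s *\<^sub>R d) \<bullet> G (x + t *\<^sub>R d))) (at t)"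
      using has_derivative_compose by blast
    then have "((\<lambda>t. f (x + t *\<^sub>R d)) has_real_derivative (G (x + t *\<^sub>R d) \<bullet> d)) (at t)"
      by (rule has_derivative_imp_has_field_derivative) (simp add: inner_commute)
    then show ?thesis
      unfolding \<phi>_def by (auto intro!: derivative_eq_intros simp: inner_diff_left)
  qed
  have "\<phi> 1 \<le> \<phi> 0"
  proof (rule DERIV_nonpos_imp_nonincreasing[where f = \<phi>])
    fix t :: real assume t: "0 \<le> t" "t \<le> 1"
    have "(G (x + t *\<^sub>R d) - G x) \<bullet> d \<le> norm (G (x + t *\<^sub>R d) - G x) * norm d"
      by (rule norm_cauchy_schwarz)
    also have "\<dots> \<le> L * norm (t *\<^sub>R d) * norm d"
      using lipschitz_onD[OF lip, of "x + t *\<^sub>R d" x]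
      by (intro mult_right_mono) (simp_all add: dist_norm)
    finally have "(G (x + t *\<^sub>R d) - G x) \<bullet> d - L * t * (norm d)\<^sup>2 \<le> 0"
      using t by (simp add: power2_eq_square mult.assoc)
    with D show "\<exists>y. (\<phi> has_real_derivative y) (at t) \<and> y \<le> 0"
      by blast
  qed simp
  then show ?thesis
    by (simp add: \<phi>_def d_def)
qed

text \<open>The Baillon-Haddad inequality, stated from the two first-order bounds so that it applies
  to \<open>f\<close> minus a quadratic, with \<open>M = L - m\<close>, which may be 0.\<close>

lemma gradient_cocoercive:
  fixes f :: "'a::real_inner \<Rightarrow> real"
  assumes lower: "\<And>x y. f x + G x \<bullet> (y - x) \<le> f y"
    and upper: "\<And>x y. f y \<le> f x + G x \<bullet> (y - x) + M / 2 * (norm (y - x))\<^sup>2"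
    and "M \<ge> 0"
  shows "(norm (G x - G y))\<^sup>2 \<le> M * ((G x - G y) \<bullet> (x - y))"
proof -
  define N where "N = (norm (G x - G y))\<^sup>2"
  define s where "s = (G x - G y) \<bullet> (x - y)"
  have half: "f x + G x \<bullet> (y - x) + (t - M / 2 * t\<^sup>2) * (norm (G x - G y))\<^sup>2 \<le> f y" for t x y
  proof -
    \<comment> \<open>A gradient step from \<open>y\<close> for \<open>f - G x \<bullet> _\<close>, which is minimized at \<open>x\<close>.\<close>
    define z where "z = y - t *\<^sub>R (G y - G x)"
    have "f x + G x \<bullet> (z - x) \<le> f y + G y \<bullet> (z - y) + M / 2 * (norm (z - y))\<^sup>2"
      using lower[of x z] upper[of z y] by linarith
    then show ?thesis
      unfolding z_def power2_norm_eq_inner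
      by (simp add: inner_simps inner_commute power2_eq_square algebra_simps)
  qed
  \<comment> \<open>Adding \<open>half\<close> for both orders of the points cancels the function
    values.\<close>
  have main: "(2 * t - M * t\<^sup>2) * N \<le> s" for t
    using half[of x y t] half[of y x t] unfolding N_def s_def
    by (simp add: norm_minus_commute[of "G y" "G x"] inner_diff algebra_simps)
  \<comment> \<open>The best step is \<open>t = 1 / M\<close>. For \<open>M = 0\<close> the left
    side of \<open>main\<close> is unbounded in \<open>t\<close> unless \<open>N = 0\<close>; the
    chosen \<open>t\<close> would give \<open>s + 1 \<le> s\<close>.\<close>
  have "N \<le> M * s"
  proof (cases "M = 0")
    case True
    have "N = 0"
    proof (rule ccontr)
      assume "N \<noteq> 0"
      then show False
        using main[of "(s + 1) / (2 * N)"] True by simp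
    qed
    then show ?thesis using True by simp
  next
    case False
    then show ?thesis
      using main[of "1 / M"] \<open>M \<ge> 0\<close> by (simp add: field_simps power2_eq_square)
  qed
  then show ?thesis by (simp add: N_def s_def)
qed

text \<open>Removing \<open>m / 2 * (norm x)\<^sup>2\<close> from \<open>f\<close> leaves a convex
  \<open>h\<close> with gradient \<open>H\<close>, and the step difference becomes
  \<open>(1 - \<mu> * m) *\<^sub>R d - \<mu> *\<^sub>R e\<close>. By cocoercivity its squared norm
  is at most an affine function of \<open>e \<bullet> d\<close>, which lies between 0 and
  \<open>(L - m) * (d \<bullet> d)\<close>.\<close>

lemma gradient_step_contraction:
  fixes f :: "'a::real_inner \<Rightarrow> real"
  assumes lower: "\<And>x y. f x + G x \<bullet> (y - x) + m / 2 * (norm (y - x))\<^sup>2 \<le> f y"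
    and upper: "\<And>x y. f y \<le> f x + G x \<bullet> (y - x) + L / 2 * (norm (y - x))\<^sup>2"
    and "m \<le> L" "\<mu> > 0"
  shows "norm ((x - \<mu> *\<^sub>R G x) - (y - \<mu> *\<^sub>R G y)) \<le> max \<bar>1 - \<mu> * m\<bar> \<bar>1 - \<mu> * L\<bar> * norm (x - y)"
proof -
  define h where "h x = f x - m / 2 * (norm x)\<^sup>2" for x
  define H where "H x = G x - m *\<^sub>R x" for x
  have quad: "m / 2 * (norm y)\<^sup>2 = m / 2 * (norm x)\<^sup>2 + (m *\<^sub>R x) \<bullet> (y - x) + m / 2 * (norm (y - x))\<^sup>2" for x y :: 'a
    unfolding power2_norm_eq_inner by (simp add: inner_simps inner_commute algebra_simps)
  have hl: "h x + H x \<bullet> (y - x) \<le> h y" for x y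
    using lower[of x y] quad[of y x] unfolding h_def H_def inner_diff_left by linarith
  have hu: "h y \<le> h x + H x \<bullet> (y - x) + (L - m) / 2 * (norm (y - x))\<^sup>2" for x y
    using upper[of y x] quad[of y x]
    unfolding h_def H_def inner_diff_left left_diff_distrib diff_divide_distrib by linarith
  define d where "d = x - y"
  define e where "e = H x - H y"
  have co: "e \<bullet> e \<le> (L - m) * (e \<bullet> d)"
    using gradient_cocoercive[OF hl hu, of x y] \<open>m \<le> L\<close>
    by (simp add: d_def e_def power2_norm_eq_inner)
  have "h y \<le> h x + H x \<bullet> (y - x) + (L - m) / 2 * (norm (y - x))\<^sup>2"
    "h x \<le> h y + H y \<bullet> (x - y) + (L - m) / 2 * (norm (x - y))\<^sup>2"
    by (rule hu)+
  then have ed: "e \<bullet> d \<le> (L - m) * (d \<bullet> d)"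
    by (simp add: e_def d_def power2_norm_eq_inner inner_diff field_simps inner_commute)
  have ed0: "0 \<le> e \<bullet> d"
    using hl[of x y] hl[of y x] by (simp add: e_def d_def inner_diff)
  have eq: "(x - \<mu> *\<^sub>R G x) - (y - \<mu> *\<^sub>R G y) = (1 - \<mu> * m) *\<^sub>R d - \<mu> *\<^sub>R e"
    by (simp add: d_def e_def H_def algebra_simps)
  have "(norm ((1 - \<mu> * m) *\<^sub>R d - \<mu> *\<^sub>R e))\<^sup>2
      = (1 - \<mu> * m)\<^sup>2 * (d \<bullet> d) - 2 * \<mu> * (1 - \<mu> * m) * (e \<bullet> d) + \<mu>\<^sup>2 * (e \<bullet> e)"
    unfolding power2_norm_eq_inner
    by (simp add: inner_simps inner_commute power2_eq_square algebra_simps)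
  also have "\<dots> \<le> (1 - \<mu> * m)\<^sup>2 * (d \<bullet> d) - 2 * \<mu> * (1 - \<mu> * m) * (e \<bullet> d) + \<mu>\<^sup>2 * ((L - m) * (e \<bullet> d))"
    using co by (intro add_left_mono mult_left_mono) auto
  also have "\<dots> = (1 - \<mu> * m)\<^sup>2 * (d \<bullet> d) + \<mu> * (\<mu> * (L + m) - 2) * (e \<bullet> d)"
    by (simp add: power2_eq_square algebra_simps)
  also have "\<dots> \<le> (max \<bar>1 - \<mu> * m\<bar> \<bar>1 - \<mu> * L\<bar>)\<^sup>2 * (d \<bullet> d)"
  \<comment> \<open>The sign of the slope decides which end is the worst:
    \<open>e \<bullet> d = 0\<close> yields the factor \<open>(1 - \<mu> * m)\<^sup>2\<close>, the
    upper end \<open>(1 - \<mu> * L)\<^sup>2\<close>.\<close>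
  proof (cases "\<mu> * (L + m) \<le> 2")
    case True
    then have "\<mu> * (\<mu> * (L + m) - 2) * (e \<bullet> d) \<le> 0"
      using ed0 \<open>\<mu> > 0\<close> by (intro mult_nonpos_nonneg mult_nonneg_nonpos) auto
    moreover have "(1 - \<mu> * m)\<^sup>2 * (d \<bullet> d) \<le> (max \<bar>1 - \<mu> * m\<bar> \<bar>1 - \<mu> * L\<bar>)\<^sup>2 * (d \<bullet> d)"
      by (intro mult_right_mono) (auto simp: abs_le_square_iff[symmetric])
    ultimately show ?thesis by linarith
  next
    case False
    then have "\<mu> * (\<mu> * (L + m) - 2) * (e \<bullet> d) \<le> \<mu> * (\<mu> * (L + m) - 2) * ((L - m) * (d \<bullet> d))"
      using ed \<open>\<mu> > 0\<close> by (intro mult_left_mono) auto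
    then have "(1 - \<mu> * m)\<^sup>2 * (d \<bullet> d) + \<mu> * (\<mu> * (L + m) - 2) * (e \<bullet> d) \<le> (1 - \<mu> * L)\<^sup>2 * (d \<bullet> d)"
      by (simp add: power2_eq_square algebra_simps)
    also have "\<dots> \<le> (max \<bar>1 - \<mu> * m\<bar> \<bar>1 - \<mu> * L\<bar>)\<^sup>2 * (d \<bullet> d)"
      by (intro mult_right_mono) (auto simp: abs_le_square_iff[symmetric])
    finally show ?thesis .
  qed
  also have "\<dots> = (max \<bar>1 - \<mu> * m\<bar> \<bar>1 - \<mu> * L\<bar> * norm d)\<^sup>2"
    by (simp add: power_mult_distrib power2_norm_eq_inner)
  finally have "norm ((1 - \<mu> * m) *\<^sub>R d - \<mu> *\<^sub>R e) \<le> max \<bar>1 - \<mu> * m\<bar> \<bar>1 - \<mu> * L\<bar> * norm d"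
    by (rule power2_le_imp_le) (simp add: le_max_iff_disj)
  then show ?thesis
    unfolding eq by (simp add: d_def)
qed

section \<open>Exponential decay along the flow\<close>

text \<open>With \<open>w = z s - zs\<close>, Cauchy-Schwarz and the contraction towards
  \<open>zs\<close> give \<open>w \<bullet> (T (z s) - z s) \<le> - (1 - \<sigma>) * (w \<bullet>
  w)\<close>, which exactly offsets the growth of the exponential weight in
  \<open>V\<close>.\<close>

lemma contraction_flow_exponential_decay:
  fixes z :: "real \<Rightarrow> 'a::real_inner"
  assumes sol: "ode_solution (\<lambda>x. - x + T x) z"
    and contr: "\<And>x. norm (T x - zs) \<le> \<sigma> * norm (x - zs)" and "t \<ge> 0"
  shows "norm (z t - zs) \<le> exp (- (1 - \<sigma>) * t) * norm (z 0 - zs)"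
proof -
  define \<rho> where "\<rho> = 1 - \<sigma>"
  define V where "V t = exp (2 * \<rho> * t) * ((z t - zs) \<bullet> (z t - zs))" for t
  have zd: "(z has_vector_derivative (- z s + T (z s))) (at s within {0..})" if "s \<ge> 0" for s
    using sol that by (simp add: ode_solution_def)
  have "V t \<le> V 0"
  proof (cases "t = 0")
    case False
    \<comment> \<open>At time 0 the derivative is only one-sided, so derivatives are used on the
      open interval and continuity at its ends.\<close>
    show ?thesis
    proof (rule DERIV_nonpos_imp_decreasing_open[where f = V])
      show "0 \<le> t" by fact
      have "continuous_on {0..} z"
        using zd by (auto simp: continuous_on_eq_continuous_within
            intro: has_vector_derivative_continuous)
      then have "continuous_on {0..t} z"
        by (rule continuous_on_subset) auto
      then show "continuous_on {0..t} V"
        unfolding V_def by (intro continuous_intros)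
      fix s assume s: "0 < s" "s < t"
      define w where "w = z s - zs"
      have "at s within {0..} = at s"
        using s by (intro at_within_interior) simp
      then have "(z has_derivative (\<lambda>h. h *\<^sub>R (- z s + T (z s)))) (at s)"
        using zd[of s] s by (simp add: has_vector_derivative_def)
      then have "(V has_derivative (\<lambda>h. h * (2 * exp (2 * \<rho> * s) *
          (\<rho> * (w \<bullet> w) + w \<bullet> (- z s + T (z s)))))) (at s)"
        unfolding V_def w_def
        by (auto intro!: derivative_eq_intros simp: fun_eq_iff inner_commute algebra_simps)
      then have D: "(V has_real_derivative (2 * exp (2 * \<rho> * s) *
          (\<rho> * (w \<bullet> w) + w \<bullet> (- z s + T (z s))))) (at s)"
        by (rule has_derivative_imp_has_field_derivative) simp
      have "w \<bullet> (- z s + T (z s)) = w \<bullet> (T (z s) - zs) - w \<bullet> w"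
        by (simp add: w_def inner_diff inner_add)
      also have "w \<bullet> (T (z s) - zs) \<le> norm w * (\<sigma> * norm w)"
        using order.trans[OF norm_cauchy_schwarz mult_left_mono[OF contr]]
        by (simp add: w_def)
      also have "\<dots> = \<sigma> * (w \<bullet> w)"
        by (simp add: power2_norm_eq_inner[symmetric] power2_eq_square)
      finally have "\<rho> * (w \<bullet> w) + w \<bullet> (- z s + T (z s)) \<le> 0"
        by (simp add: \<rho>_def algebra_simps)
      then have "2 * exp (2 * \<rho> * s) * (\<rho> * (w \<bullet> w) + w \<bullet> (- z s + T (z s))) \<le> 0"
        by (intro mult_nonneg_nonpos) auto
      with D show "\<exists>y. (V has_real_derivative y) (at s) \<and> y \<le> 0"
        by blast
    qed
  qed simp
  moreover have "V s = (exp (\<rho> * s) * norm (z s - zs))\<^sup>2" for s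
    by (simp add: V_def power_mult_distrib power2_norm_eq_inner exp_double[symmetric] mult.assoc)
  ultimately have "(exp (\<rho> * t) * norm (z t - zs))\<^sup>2 \<le> (norm (z 0 - zs))\<^sup>2"
    by simp
  then have "exp (\<rho> * t) * norm (z t - zs) \<le> norm (z 0 - zs)"
    by (rule power2_le_imp_le) simp
  then show ?thesis
    by (simp add: \<rho>_def[symmetric] exp_minus field_simps)
qed

theorem theorem2:
  fixes f :: "real ^ 'n \<Rightarrow> real" and g :: "real ^ 'n \<Rightarrow> ereal"
    and m\<^sub>f L\<^sub>f \<mu> \<sigma> :: real
  assumes "m\<^sub>f > 0" and "strongly_convex m\<^sub>f f"
    and "L\<^sub>f-lipschitz_on UNIV (gradient f)"
    and "proper_fun g" and "closed_fun g" and "convex_fun g"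
    and "\<mu> \<in> {0<..<2 / L\<^sub>f}"
    and "\<sigma> = max \<bar>1 - \<mu> * m\<^sub>f\<bar> \<bar>1 - \<mu> * L\<^sub>f\<bar>"
  shows "\<exists>zs.
    (\<forall>z. equilibrium (prox_grad_field \<mu> f g) z \<longleftrightarrow> z = zs) \<and>
    (\<exists>c>0. \<exists>\<rho>\<in>{0<..1 - \<sigma>}.
       \<forall>z. ode_solution (prox_grad_field \<mu> f g) z \<longrightarrow>
         (\<forall>t\<ge>0. norm (z t - zs) \<le> c * exp (- \<rho> * t) * norm (z 0 - zs))) \<and>
    (\<forall>x. is_arg_min (\<lambda>x. ereal (f x) + g x) (\<lambda>x. True) x \<longleftrightarrow> x = zs)"
proof -
  note g = assms(4-6)
  define G where "G = gradient f"
  define T where "T z = prox \<mu> g (z - \<mu> *\<^sub>R G z)" for z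
  let ?min = "is_arg_min (\<lambda>x. ereal (f x) + g x) (\<lambda>x. True)"
  have "\<mu> > 0" "\<mu> < 2 / L\<^sub>f"
    using assms(7) by auto
  \<comment> \<open>Otherwise \<open>2 / L\<^sub>f \<le> 0\<close> (division by zero gives 0) and no
    \<open>\<mu>\<close> would fit.\<close>
  then have "L\<^sub>f > 0"
    by (metis less_trans zero_less_divide_iff zero_less_numeral not_less_iff_gr_or_eq)
  with \<open>\<mu> < 2 / L\<^sub>f\<close> have "\<mu> * L\<^sub>f < 2"
    by (simp add: field_simps)
  have diff: "f differentiable (at x)" for x
    using assms(2) by (simp add: strongly_convex_def)
  have lower: "f x + G x \<bullet> (y - x) + m\<^sub>f / 2 * (norm (y - x))\<^sup>2 \<le> f y" for x y
    using assms(2) by (simp add: strongly_convex_def G_def)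
  have lower0: "f x + G x \<bullet> (y - x) \<le> f y" for x y
  proof -
    have "0 \<le> m\<^sub>f / 2 * (norm (y - x))\<^sup>2"
      using assms(1) by simp
    then show ?thesis using lower[of x y] by linarith
  qed
  have upper: "f y \<le> f x + G x \<bullet> (y - x) + L\<^sub>f / 2 * (norm (y - x))\<^sup>2" for x y
    unfolding G_def by (rule lipschitz_gradient_upper_bound[OF GDERIV_gradient[OF diff] assms(3)])
  \<comment> \<open>Compare the quadratic bounds on \<open>f\<close> at a unit vector
    \<open>b\<close>, expanded at 0.\<close>
  have "m\<^sub>f \<le> L\<^sub>f"
  proof -
    obtain b :: "real ^ 'n" where "b \<in> Basis"
      using nonempty_Basis by blast
    then show ?thesis
      using order.trans[OF lower[of 0 b] upper[of b 0]] by simp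
  qed
  have "\<mu> * m\<^sub>f \<le> \<mu> * L\<^sub>f" "0 < \<mu> * m\<^sub>f"
    using \<open>m\<^sub>f \<le> L\<^sub>f\<close> \<open>\<mu> > 0\<close> assms(1) by simp_all
  \<comment> \<open>Both products lie strictly between 0 and 2.\<close>
  then have "\<sigma> < 1"
    using \<open>\<mu> * L\<^sub>f < 2\<close> assms(8) by (simp add: abs_less_iff)
  have contr: "norm (T x - T y) \<le> \<sigma> * norm (x - y)" for x y
    unfolding T_def assms(8)
    using prox_nonexpansive[OF g \<open>\<mu> > 0\<close>]
      gradient_step_contraction[OF lower upper \<open>m\<^sub>f \<le> L\<^sub>f\<close> \<open>\<mu> > 0\<close>] by (rule order.trans)
  \<comment> \<open>For \<open>v = x - \<mu> *\<^sub>R G x\<close> the vector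
    \<open>(1 / \<mu>) *\<^sub>R (v - x)\<close> is \<open>- G x\<close>.\<close>
  have fixed: "T x = x \<longleftrightarrow> ?min x" for x
  proof -
    have "T x = x \<longleftrightarrow> subgradient g x (- G x)"
      using \<open>\<mu> > 0\<close> by (simp add: T_def prox_eq_iff_subgradient[OF g])
    then show ?thesis
      using minimizer_imp_subgradient[OF g(1,3) upper] subgradient_imp_minimizer[OF lower0]
      by blast
  qed
  have field: "prox_grad_field \<mu> f g = (\<lambda>z. - z + T z)"
    by (simp add: prox_grad_field_def T_def G_def fun_eq_iff)
  have "continuous_on UNIV f"
    using diff by (auto intro!: continuous_at_imp_continuous_on differentiable_imp_continuous_within)
  \<comment> \<open>The equilibrium is obtained as a minimizer of \<open>f + g\<close>; the
    contraction then gives its uniqueness, and with it that of the minimizer.\<close>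
  then obtain zs where "?min zs"
    by (rule composite_minimizer_exists[OF g _ assms(1) lower])
  then have zs: "T zs = zs"
    by (simp add: fixed)
  have unique: "T x = x \<longleftrightarrow> x = zs" for x
  proof
    assume "T x = x"
    then have "(1 - \<sigma>) * norm (x - zs) \<le> 0"
      using contr[of x zs] zs by (simp add: algebra_simps)
    then show "x = zs"
      using \<open>\<sigma> < 1\<close> by (simp add: mult_le_0_iff)
  qed (simp add: zs)
  have decay: "norm (z t - zs) \<le> 1 * exp (- (1 - \<sigma>) * t) * norm (z 0 - zs)"
    if "ode_solution (prox_grad_field \<mu> f g) z" "t \<ge> 0" for z t
    using contraction_flow_exponential_decay[of T z zs \<sigma> t] that contr[of _ zs] zs field by simp
  show ?thesis
  proof (intro exI[of _ zs] conjI allI)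
    show "equilibrium (prox_grad_field \<mu> f g) z \<longleftrightarrow> z = zs" for z
      unfolding equilibrium_def field unique[symmetric] by (simp add: algebra_simps)
    show "?min x \<longleftrightarrow> x = zs" for x
      using fixed unique by blast
    show "\<exists>c>0. \<exists>\<rho>\<in>{0<..1 - \<sigma>}.
       \<forall>z. ode_solution (prox_grad_field \<mu> f g) z \<longrightarrow>
         (\<forall>t\<ge>0. norm (z t - zs) \<le> c * exp (- \<rho> * t) * norm (z 0 - zs))"
      using \<open>\<sigma> < 1\<close> decay by (intro exI[of _ 1] conjI bexI[of _ "1 - \<sigma>"]) auto
  qed
qed

end
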